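(* Let $A\in\mathbb{R}\setminus\{0\}$ and $B,a_0,b_0\in\mathbb{R}$ with $a_0+b_0=B$, and put $a(\epsilon)=a_0+\frac{A}{\epsilon}$, $b(\epsilon)=b_0-\frac{A}{\epsilon}$ for $\epsilon\in(0,1]$; assume $b(\epsilon)\ne0$ for all $\epsilon\in(0,1]$. Let $\psi\in L^2(\mathbb{R})$. For any $x\in\mathbb{R}$ and $(q,p)\in\mathbb{R}^2$, $$\lim_{\epsilon\to0^+}|\psi_\epsilon^{a(\epsilon),b(\epsilon)}(q,p)\rangle(x)=|\psi^{\eta^{A,B}}_{\sigma_H(q,p)}\rangle(x),$$ and $$\lim_{\epsilon\to0^+}|\psi_\epsilon^{a(\epsilon),b(\epsilon)}(q,p)\rangle=|\psi^{\eta^{A,B}}_{\sigma_H(q,p)}\rangle\quad\text{in }L^2(\mathbb{R},dx),$$ i.e., the convergence of coherent states is pointwise and also in $L^2(\mathbb{R},dx)$.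
   Context: Heisenberg group $H$: the set $\mathbb{R}\times\mathbb{R}^2$ with product $(x_1,(y_1,z_1))(x_2,(y_2,z_2))=(x_1+x_2,\,(y_1+y_2+x_1z_2,\ z_1+z_2))$; its representation $\eta^{A,B}$ on $L^2(\mathbb{R})$ is $(\eta^{A,B}(c,(v_1,v_2))f)(x)=e^{i[A(v_1+xv_2)+Bv_2]}f(c+x)$. Its coherent states are $|\psi^{\eta^{A,B}}_{\sigma_H(q,p)}\rangle=\eta^{A,B}\big(q,(\tfrac{qp}{2},p)\big)\psi$. Extended affine group $EA$: the set $\mathbb{R}^+\times\mathbb{R}\times\mathbb{R}$ with product $(\alpha,\beta,\gamma)(x,y,z)=(\alpha x,\alpha y+\beta,\gamma+z)$; for $\epsilon\in(0,1]$, $a\in\mathbb{R}$, $b\in\mathbb{R}\setminus\{0\}$ its representation $\rho_\epsilon^{a,b}$ on $L^2(\mathbb{R})$ is $(\rho_\epsilon^{a,b}(\alpha,\beta,\gamma)f)(x)=e^{ia\gamma}e^{ib\beta e^{-\epsilon x}}f\big(x-\tfrac{\log\alpha}{\epsilon}\big)$. With $P_\epsilon(x,(y,z))=\big(e^{-\epsilon x},\ z\tfrac{e^{-\epsilon x}-1}{-\epsilon x},\ z+\epsilon(y-\tfrac{xz}{2})\big)$ (fraction $=1$ at $x=0$), its coherent states are $|\psi_\epsilon^{a,b}(q,p)\rangle=\rho_\epsilon^{a,b}\big(P_\epsilon(q,(\tfrac{qp}{2},p))\big)\psi$. In the pointwise statement, $\psi$ is a fixed function representing its class and the representations act by the displayed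 formulas. *)

theory Defs
  imports "HOL-Analysis.Analysis"
begin

section \<open>Square-integrable functions\<close>

text \<open>
  Elements of L2(R, dx) are handled through representatives: complex functions that are
  Lebesgue measurable and whose squared modulus is Lebesgue integrable.
\<close>

definition square_integrable :: "(real \<Rightarrow> complex) \<Rightarrow> bool" where
  "square_integrable f \<longleftrightarrow>
     f \<in> borel_measurable lebesgue \<and> integrable lebesgue (\<lambda>x. (cmod (f x))\<^sup>2)"

definition L2_norm :: "(real \<Rightarrow> complex) \<Rightarrow> real" where
  "L2_norm f = sqrt (LINT x|lebesgue. (cmod (f x))\<^sup>2)"

text \<open>
  The membership conditions are needed because the Bochner integral of a non-integrable
  function is 0 by convention.
\<close>

definition tendsto_L2 :: "('e \<Rightarrow> real \<Rightarrow> complex) \<Rightarrow> (real \<Rightarrow> complex) \<Rightarrow> 'e filter \<Rightarrow> bool" where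
  "tendsto_L2 f g F \<longleftrightarrow>
     (\<forall>\<^sub>F e in F. square_integrable (f e)) \<and> square_integrable g \<and>
     ((\<lambda>e. L2_norm (\<lambda>x. f e x - g x)) \<longlongrightarrow> 0) F"

section \<open>The Heisenberg group\<close>

type_synonym heis = "real \<times> (real \<times> real)"

fun heis_mult :: "heis \<Rightarrow> heis \<Rightarrow> heis" where
  "heis_mult (x1, (y1, z1)) (x2, (y2, z2)) = (x1 + x2, (y1 + y2 + x1 * z2, z1 + z2))"

fun eta :: "real \<Rightarrow> real \<Rightarrow> heis \<Rightarrow> (real \<Rightarrow> complex) \<Rightarrow> real \<Rightarrow> complex" where
  "eta A B (c, (v1, v2)) f x =
     exp (\<i> * complex_of_real (A * (v1 + x * v2) + B * v2)) * f (c + x)"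

lemma eta_heis_mult: "eta A B g (eta A B h f) = eta A B (heis_mult g h) f"
  by (cases g; cases h) (auto simp: fun_eq_iff algebra_simps simp flip: exp_add)

definition sigma_H :: "real \<times> real \<Rightarrow> heis" where
  "sigma_H = (\<lambda>(q, p). (q, (q * p / 2, p)))"

definition coherent_H ::
  "real \<Rightarrow> real \<Rightarrow> (real \<Rightarrow> complex) \<Rightarrow> real \<times> real \<Rightarrow> real \<Rightarrow> complex" where
  "coherent_H A B \<psi> qp = eta A B (sigma_H qp) \<psi>"

section \<open>The extended affine group\<close>

text \<open>The underlying set consists of the triples whose first component is positive.\<close>

type_synonym ext_aff = "real \<times> real \<times> real"

definition EA_carrier :: "ext_aff set" where
  "EA_carrier = {0<..} \<times> UNIV \<times> UNIV"

fun EA_mult :: "ext_aff \<Rightarrow> ext_aff \<Rightarrow> ext_aff" where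
  "EA_mult (\<alpha>, \<beta>, \<gamma>) (x, y, z) = (\<alpha> * x, \<alpha> * y + \<beta>, \<gamma> + z)"

fun rho :: "real \<Rightarrow> real \<Rightarrow> real \<Rightarrow> ext_aff \<Rightarrow> (real \<Rightarrow> complex) \<Rightarrow> real \<Rightarrow> complex" where
  "rho \<epsilon> a b (\<alpha>, \<beta>, \<gamma>) f x =
     exp (\<i> * complex_of_real (a * \<gamma>)) *
     exp (\<i> * complex_of_real (b * \<beta> * exp (- \<epsilon> * x))) *
     f (x - ln \<alpha> / \<epsilon>)"

lemma rho_EA_mult:
  assumes "\<epsilon> > 0" "g \<in> EA_carrier" "h \<in> EA_carrier"
  shows "rho \<epsilon> a b g (rho \<epsilon> a b h f) = rho \<epsilon> a b (EA_mult g h) f"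
proof -
  obtain \<alpha> \<beta> \<gamma> where g: "g = (\<alpha>, \<beta>, \<gamma>)" by (cases g)
  obtain x y z where h: "h = (x, y, z)" by (cases h)
  from assms have pos: "\<alpha> > 0" "x > 0" by (auto simp: EA_carrier_def g h)
  have "- \<epsilon> * (t - ln \<alpha> / \<epsilon>) = ln \<alpha> + - \<epsilon> * t" for t
    using assms(1) by (simp add: field_simps)
  then have shift: "exp (- \<epsilon> * (t - ln \<alpha> / \<epsilon>)) = \<alpha> * exp (- \<epsilon> * t)" for t
    using pos by (simp only: exp_add exp_ln)
  have arg: "t - ln \<alpha> / \<epsilon> - ln x / \<epsilon> = t - ln (\<alpha> * x) / \<epsilon>" for t
    using pos by (simp add: ln_mult add_divide_distrib)
  show ?thesis
    unfolding g h fun_eq_iff rho.simps EA_mult.simps shift arg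
    by (simp add: algebra_simps flip: exp_add)
qed

fun P_eps :: "real \<Rightarrow> heis \<Rightarrow> ext_aff" where
  "P_eps \<epsilon> (x, (y, z)) =
     (exp (- \<epsilon> * x),
      z * (if x = 0 then 1 else (exp (- \<epsilon> * x) - 1) / (- \<epsilon> * x)),
      z + \<epsilon> * (y - x * z / 2))"

lemma P_eps_in_EA_carrier: "P_eps \<epsilon> g \<in> EA_carrier"
  by (cases g) (auto simp: EA_carrier_def)

definition coherent_EA ::
  "real \<Rightarrow> real \<Rightarrow> real \<Rightarrow> (real \<Rightarrow> complex) \<Rightarrow> real \<times> real \<Rightarrow> real \<Rightarrow> complex" where
  "coherent_EA \<epsilon> a b \<psi> qp = rho \<epsilon> a b (P_eps \<epsilon> (sigma_H qp)) \<psi>"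

end

theory Submission
  imports Defs "HOL-Real_Asymp.Real_Asymp"
begin

text \<open>
  Both families of coherent states are the translate \<open>x \<mapsto> \<psi> (q + x)\<close> multiplied by a unimodular
  phase. The phases converge pointwise because the singular parts \<open>\<plusminus> A / \<epsilon>\<close> of \<open>a\<close> and \<open>b\<close> combine
  to \<open>A p\<close> times a difference quotient at \<open>\<epsilon> = 0\<close>, and the multiple \<open>4 \<bar>\<psi> (q + x)\<bar>\<^sup>2\<close> dominates the
  squared difference, which gives convergence in the mean.
\<close>

definition affine_phase ::
  "real \<Rightarrow> real \<Rightarrow> real \<Rightarrow> real \<Rightarrow> real \<Rightarrow> real \<Rightarrow> real" where
  "affine_phase a b q p \<epsilon> x =
     a * p + b * (p * (if q = 0 then 1 else (exp (- \<epsilon> * q) - 1) / (- \<epsilon> * q))) * exp (- \<epsilon> * x)"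

definition heis_phase :: "real \<Rightarrow> real \<Rightarrow> real \<Rightarrow> real \<Rightarrow> real \<Rightarrow> real" where
  "heis_phase A B q p x = A * (q * p / 2 + x * p) + B * p"

text \<open>On the section \<open>sigma_H\<close> the term \<epsilon> (y - x z / 2) of
  \<open>P_eps\<close> vanishes because y = q p / 2, so the third component is just p. The first
  component has logarithm - \<epsilon> q, and dividing by \<epsilon> \<noteq> 0 gives a translation
  by q independent of \<epsilon>.\<close>

lemma coherent_EA_eq_phase:
  assumes "\<epsilon> \<noteq> 0"
  shows "coherent_EA \<epsilon> a b \<psi> (q, p) =
    (\<lambda>x. exp (\<i> * complex_of_real (affine_phase a b q p \<epsilon> x)) * \<psi> (q + x))"
  using assms
  by (auto simp: coherent_EA_def sigma_H_def affine_phase_def fun_eq_iff algebra_simps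
           simp flip: exp_add)

lemma coherent_H_eq_phase:
  "coherent_H A B \<psi> (q, p) =
    (\<lambda>x. exp (\<i> * complex_of_real (heis_phase A B q p x)) * \<psi> (q + x))"
  by (simp add: coherent_H_def sigma_H_def heis_phase_def fun_eq_iff)

text \<open>To first order the quotient is 1 - \<epsilon> q / 2 and the exponential is 1 -
  \<epsilon> x, so their product is 1 - \<epsilon> (q / 2 + x). The terms of order 1 / \<epsilon>
  cancel, A p (q / 2 + x) survives from the next order, and a0 and b0 contribute (a0 + b0)
  p.\<close>

lemma affine_phase_tendsto_heis_phase:
  "((\<lambda>\<epsilon>. affine_phase (a0 + A / \<epsilon>) (b0 - A / \<epsilon>) q p \<epsilon> x)
      \<longlongrightarrow> heis_phase A (a0 + b0) q p x) (at_right 0)"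
proof (cases "q = 0")
  case True
  have "((\<lambda>\<epsilon>. (a0 + A / \<epsilon>) * p + (b0 - A / \<epsilon>) * p * exp (- \<epsilon> * x))
          \<longlongrightarrow> A * x * p + (a0 + b0) * p) (at_right 0)"
    by (real_asymp simp: algebra_simps)
  then show ?thesis
    using True by (simp add: affine_phase_def heis_phase_def algebra_simps)
next
  case False
  have "((\<lambda>\<epsilon>. (a0 + A / \<epsilon>) * p + (b0 - A / \<epsilon>) *
            (p * ((exp (- \<epsilon> * q) - 1) / (- \<epsilon> * q))) * exp (- \<epsilon> * x))
          \<longlongrightarrow> A * (q * p / 2 + x * p) + (a0 + b0) * p) (at_right 0)"
    using False by (real_asymp simp: field_simps)
  then show ?thesis
    using False by (simp add: affine_phase_def heis_phase_def algebra_simps)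
qed

lemma continuous_imp_lebesgue_measurable:
  fixes f :: "real \<Rightarrow> real"
  assumes "continuous_on UNIV f"
  shows "f \<in> borel_measurable lebesgue"
  using borel_measurable_continuous_onI[OF assms] by (intro measurable_completion) simp

lemma square_integrable_translate:
  assumes "square_integrable f"
  shows "square_integrable (\<lambda>x. f (c + x))"
proof -
  \<comment> \<open>As \<open>f\<close> is only Lebesgue measurable, composing with it requires the
    translation to be measurable for the completed sigma-algebra on both sides; Borel measurability
    would not be enough.\<close>
  have T: "(\<lambda>x. c + x) \<in> lebesgue \<rightarrow>\<^sub>M (lebesgue :: real measure)"
    using lebesgue_affine_measurable[of "\<lambda>_. 1::real" c] by simp
  have "integrable lebesgue (\<lambda>x. (cmod (f (c + x)))\<^sup>2)"
    using assms lebesgue_integrable_real_affine_iff[of 1 "\<lambda>x. (cmod (f x))\<^sup>2" c]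
    by (simp add: square_integrable_def)
  with measurable_compose[OF T] assms show ?thesis
    by (auto simp: square_integrable_def)
qed

lemma square_integrable_phase_mult:
  assumes "square_integrable f" "\<theta> \<in> borel_measurable lebesgue"
  shows "square_integrable (\<lambda>x. exp (\<i> * complex_of_real (\<theta> x)) * f x)"
  using assms by (auto simp: square_integrable_def norm_mult)

lemma tendsto_L2_phase_mult:
  fixes \<theta> :: "real \<Rightarrow> real \<Rightarrow> real"
  assumes f: "square_integrable f"
    and meas: "\<And>\<epsilon>. \<theta> \<epsilon> \<in> borel_measurable lebesgue" "\<theta>\<^sub>0 \<in> borel_measurable lebesgue"
    and lim: "\<And>x. ((\<lambda>\<epsilon>. \<theta> \<epsilon> x) \<longlongrightarrow> \<theta>\<^sub>0 x) (at_right 0)"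
  shows "tendsto_L2 (\<lambda>\<epsilon> x. exp (\<i> * complex_of_real (\<theta> \<epsilon> x)) * f x)
           (\<lambda>x. exp (\<i> * complex_of_real (\<theta>\<^sub>0 x)) * f x) (at_right 0)"
proof -
  define d where "d \<epsilon> x = (cmod (exp (\<i> * complex_of_real (\<theta> \<epsilon> x)) * f x
                             - exp (\<i> * complex_of_real (\<theta>\<^sub>0 x)) * f x))\<^sup>2" for \<epsilon> x
  have fm[measurable]: "f \<in> borel_measurable lebesgue"
    using f by (simp add: square_integrable_def)
  note meas[measurable]
  \<comment> \<open>The substitution \<epsilon> = 1 / t turns the limit at 0 from the right into one
    at infinity, where dominated convergence is applied with a continuous parameter.\<close>
  have "((\<lambda>t. LINT x|lebesgue. d (inverse t) x) \<longlongrightarrow> (LINT (x::real)|lebesgue. (0::real))) at_top"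
  proof (rule integral_dominated_convergence_at_top[where s = "\<lambda>t. d (inverse t)"
        and w = "\<lambda>x. 4 * (cmod (f x))\<^sup>2"])
    show "integrable lebesgue (\<lambda>x. 4 * (cmod (f x))\<^sup>2)"
      using f by (simp add: square_integrable_def)
    show "d (inverse t) \<in> borel_measurable lebesgue" for t
      unfolding d_def[abs_def] by measurable
    show "\<forall>\<^sub>F t in at_top. AE x in lebesgue. norm (d (inverse t) x) \<le> 4 * (cmod (f x))\<^sup>2"
    proof (intro always_eventually allI AE_I2)
      fix t x :: real
      \<comment> \<open>Both phases have modulus 1, so the triangle inequality suffices; squaring
        produces the factor 4.\<close>
      have "cmod (exp (\<i> * complex_of_real (\<theta> (inverse t) x)) * f x
              - exp (\<i> * complex_of_real (\<theta>\<^sub>0 x)) * f x) \<le> 2 * cmod (f x)"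
        by (rule order_trans[OF norm_triangle_ineq4]) (simp add: norm_mult)
      from power_mono[OF this, of 2] show "norm (d (inverse t) x) \<le> 4 * (cmod (f x))\<^sup>2"
        by (simp add: d_def power_mult_distrib)
    qed
    show "AE x in lebesgue. ((\<lambda>t. d (inverse t) x) \<longlongrightarrow> 0) at_top"
    proof (rule AE_I2)
      fix x :: real
      have "((\<lambda>\<epsilon>. d \<epsilon> x) \<longlongrightarrow> (cmod (exp (\<i> * complex_of_real (\<theta>\<^sub>0 x)) * f x
              - exp (\<i> * complex_of_real (\<theta>\<^sub>0 x)) * f x))\<^sup>2) (at_right 0)"
        unfolding d_def by (intro tendsto_intros lim)
      then show "((\<lambda>t. d (inverse t) x) \<longlongrightarrow> 0) at_top"
        by (simp add: filterlim_at_right_to_top)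
    qed
  qed simp
  then have "((\<lambda>\<epsilon>. sqrt (LINT x|lebesgue. d \<epsilon> x)) \<longlongrightarrow> sqrt 0) (at_right 0)"
    by (intro tendsto_real_sqrt) (simp add: filterlim_at_right_to_top)
  then show ?thesis
    using f meas
    by (auto simp: tendsto_L2_def L2_norm_def d_def square_integrable_phase_mult)
qed

text \<open>Needed because \<open>a\<close> and \<open>b\<close> are prescribed only on (0, 1], so
  the phase form of the affine states is available only eventually.\<close>

lemma tendsto_L2_cong:
  assumes "\<forall>\<^sub>F e in F. f e = g e" "tendsto_L2 f h F"
  shows "tendsto_L2 g h F"
proof -
  have "((\<lambda>e. L2_norm (\<lambda>x. g e x - h x)) \<longlongrightarrow> 0) F"
    using assms by (auto simp: tendsto_L2_def elim!: Lim_transform_eventually eventually_mono)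
  with assms show ?thesis
    by (auto simp: tendsto_L2_def elim: eventually_elim2)
qed

theorem mainTheorem6:
  fixes A B a0 b0 :: real and a b :: "real \<Rightarrow> real" and \<psi> :: "real \<Rightarrow> complex"
  assumes "A \<noteq> 0"
    and "a0 + b0 = B"
    and "\<And>\<epsilon>. \<epsilon> \<in> {0<..1} \<Longrightarrow> a \<epsilon> = a0 + A / \<epsilon>"
    and "\<And>\<epsilon>. \<epsilon> \<in> {0<..1} \<Longrightarrow> b \<epsilon> = b0 - A / \<epsilon>"
    and "\<And>\<epsilon>. \<epsilon> \<in> {0<..1} \<Longrightarrow> b \<epsilon> \<noteq> 0"
    and "square_integrable \<psi>"
  shows "(\<forall>x q p. ((\<lambda>\<epsilon>. coherent_EA \<epsilon> (a \<epsilon>) (b \<epsilon>) \<psi> (q, p) x)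
                     \<longlongrightarrow> coherent_H A B \<psi> (q, p) x) (at_right 0)) \<and>
         (\<forall>q p. tendsto_L2 (\<lambda>\<epsilon>. coherent_EA \<epsilon> (a \<epsilon>) (b \<epsilon>) \<psi> (q, p))
                     (coherent_H A B \<psi> (q, p)) (at_right 0))"
proof -
  define \<theta> where "\<theta> q p \<epsilon> = affine_phase (a0 + A / \<epsilon>) (b0 - A / \<epsilon>) q p \<epsilon>" for q p \<epsilon>
  have lim: "((\<lambda>\<epsilon>. \<theta> q p \<epsilon> x) \<longlongrightarrow> heis_phase A B q p x) (at_right 0)" for q p x
    using affine_phase_tendsto_heis_phase assms(2) by (auto simp: \<theta>_def)
  have "\<forall>\<^sub>F \<epsilon> in at_right (0::real). \<epsilon> \<in> {0<..1}"
    by (auto simp: eventually_at_right_field intro!: exI[of _ 1])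
  then have EA: "\<forall>\<^sub>F \<epsilon> in at_right 0.
      (\<lambda>x. exp (\<i> * complex_of_real (\<theta> q p \<epsilon> x)) * \<psi> (q + x))
        = coherent_EA \<epsilon> (a \<epsilon>) (b \<epsilon>) \<psi> (q, p)" for q p
    by eventually_elim (simp add: \<theta>_def assms(3,4) coherent_EA_eq_phase)
  have "((\<lambda>\<epsilon>. coherent_EA \<epsilon> (a \<epsilon>) (b \<epsilon>) \<psi> (q, p) x)
           \<longlongrightarrow> coherent_H A B \<psi> (q, p) x) (at_right 0)" for q p x
  proof (rule Lim_transform_eventually)
    show "((\<lambda>\<epsilon>. exp (\<i> * complex_of_real (\<theta> q p \<epsilon> x)) * \<psi> (q + x))
            \<longlongrightarrow> coherent_H A B \<psi> (q, p) x) (at_right 0)"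
      unfolding coherent_H_eq_phase by (intro tendsto_intros lim)
  qed (use EA[of q p] in eventually_elim, metis)
  moreover have "tendsto_L2 (\<lambda>\<epsilon>. coherent_EA \<epsilon> (a \<epsilon>) (b \<epsilon>) \<psi> (q, p))
                   (coherent_H A B \<psi> (q, p)) (at_right 0)" for q p
  \<comment> \<open>With both families in phase form over the same translate of \<psi>, only
    measurability of the phases remains.\<close>
  proof (rule tendsto_L2_cong[OF EA], unfold coherent_H_eq_phase,
      rule tendsto_L2_phase_mult[OF square_integrable_translate[OF assms(6)] _ _ lim])
    \<comment> \<open>For fixed parameters the phase is continuous in x. This covers every real
      \<epsilon>, including 0, since the divisions do not involve x.\<close>
    show "\<theta> q p \<epsilon> \<in> borel_measurable lebesgue" for \<epsilon>
      unfolding \<theta>_def affine_phase_def[abs_def]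
      by (intro continuous_imp_lebesgue_measurable continuous_intros)
    show "heis_phase A B q p \<in> borel_measurable lebesgue"
      unfolding heis_phase_def[abs_def]
      by (intro continuous_imp_lebesgue_measurable continuous_intros)
  qed
  ultimately show ?thesis by blast
qed

end
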